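(* Let $\Sigma$ be a finite state set, let $\mathcal{R}$ be a finite set of local rules with state set $\Sigma$ and a common neighbourhood $N$ in $\mathbb{Z}$, and let $\theta \in \mathcal{R}^{\mathbb{Z}}$ be a rule distribution that is asymptotic to a recurrent rule distribution $\phi \in \mathcal{R}^{\mathbb{Z}}$. If the global update rule $H_\theta:\Sigma^{\mathbb{Z}}\to\Sigma^{\mathbb{Z}}$ is injective, then it is surjective.
   Context: A neighbourhood is a tuple $N = (n_1,\ldots,n_m)$ of integers. A local rule with state set $\Sigma$ and neighbourhood $N$ is a function $f:\Sigma^m \to \Sigma$. A configuration over a finite set $S$ is a function $c:\mathbb{Z} \to S$. A rule distribution is a configuration $\theta \in \mathcal{R}^{\mathbb{Z}}$, where $\mathcal{R}$ is a finite set of local rules with the same state set $\Sigma$ and neighbourhood $N$. Its global update rule is $H_\theta:\Sigma^{\mathbb{Z}}\to\Sigma^{\mathbb{Z}}$, $$H_\theta(c)(x) = \theta(x)\big(c(x+n_1),\ldots,c(x+n_m)\big)\quad\text{for all } x \in \mathbb{Z}.$$ Two configurations $c,e$ over the same finite set are asymptotic if $\{x\in\mathbb{Z} : c(x)\neq e(x)\}$ is finite. A configuration $c$ is recurrent if every finite pattern that appears in it appears at least twice: for every nonempty finite $D\subseteq\mathbb{Z}$ there is $r\in\mathbb{Z}$, $r\neq 0$, such that $c(x+r)=c(x)$ for all $x\in D$. *)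

theory Defs
  imports Main "HOL-Library.FuncSet"
begin

definition configurations :: "'a set \<Rightarrow> (int \<Rightarrow> 'a) set" where
  "configurations S = (UNIV \<rightarrow> S)"

text \<open>
  The set of maps from \<open>S\<^sup>m\<close> to \<open>S\<close>, where \<open>m = length N\<close> and \<open>S\<^sup>m\<close> is the set of lists of length
  \<open>m\<close> with entries in \<open>S\<close>. Rules are extensional, so that equality of rules is equality as maps
  on \<open>S\<^sup>m\<close>; this matters below, where rule distributions are compared for equality of values.
\<close>

definition local_rules :: "'a set \<Rightarrow> int list \<Rightarrow> ('a list \<Rightarrow> 'a) set" where
  "local_rules S N = {xs. set xs \<subseteq> S \<and> length xs = length N} \<rightarrow>\<^sub>E S"

definition global_update ::
    "int list \<Rightarrow> (int \<Rightarrow> 'a list \<Rightarrow> 'a) \<Rightarrow> (int \<Rightarrow> 'a) \<Rightarrow> (int \<Rightarrow> 'a)" where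
  "global_update N \<theta> c = (\<lambda>x. \<theta> x (map (\<lambda>n. c (x + n)) N))"

definition asymptotic :: "(int \<Rightarrow> 'b) \<Rightarrow> (int \<Rightarrow> 'b) \<Rightarrow> bool" where
  "asymptotic c e \<longleftrightarrow> finite {x. c x \<noteq> e x}"

definition recurrent :: "(int \<Rightarrow> 'b) \<Rightarrow> bool" where
  "recurrent c \<longleftrightarrow> (\<forall>D. finite D \<and> D \<noteq> {} \<longrightarrow> (\<exists>r. r \<noteq> 0 \<and> (\<forall>x\<in>D. c (x + r) = c x)))"

end

(* Let k bound the moduli of the entries of N, and let s be the number of states. If a rule
   distribution occurs infinitely often in theta as a pattern on a window W, then no pattern on W
   has more than s^(2k) preimages on the k-neighbourhood of W: otherwise prescribing that pattern on
   many disjoint occurrences of W would give more configurations, equal outside a bounded set,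
   than images, against injectivity. By recurrence this applies to the restriction of phi to every W.

   If the global update rule of theta is not surjective, some window W carries an orphan, so by
   averaging some pattern on W has more than s^(2k) preimages. By compactness and injectivity these
   agree near the finite set where theta and phi differ, once W is large. Passing from theta to phi
   therefore changes their common image in the same way, so phi has a pattern on W with too many
   preimages. *)

theory Submission
  imports Defs "HOL-Library.Diagonal_Subsequence" "HOL-Library.Infinite_Set"
    "HOL-Library.Nat_Bijection"
begin

section \<open>Recurrence\<close>

text \<open>Recurrence provides only one nonzero shift. If the set of all shifts were finite,
  recurrence could be applied to the union \<open>D'\<close> of the translates of \<open>D\<close>
  by them. The resulting \<open>s\<close> can be added to any shift, so starting from 0 every
  multiple of \<open>s\<close> is a shift.\<close>

lemma infinite_recurrence_shifts:
  assumes "recurrent \<phi>" and "finite D" and "D \<noteq> {}"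
  shows "infinite {r. \<forall>x\<in>D. \<phi> (x + r) = \<phi> x}" (is "infinite ?X")
proof
  assume fin: "finite ?X"
  have "0 \<in> ?X" by simp
  define D' where "D' = (\<Union>r\<in>?X. (\<lambda>x. x + r) ` D)"
  have "finite D'" "D' \<noteq> {}"
    using fin assms(2,3) \<open>0 \<in> ?X\<close> unfolding D'_def by blast+
  then obtain s where s: "s \<noteq> 0" "\<forall>x\<in>D'. \<phi> (x + s) = \<phi> x"
    using assms(1) unfolding recurrent_def by blast
  have closed: "r + s \<in> ?X" if "r \<in> ?X" for r
  proof -
    have "\<phi> (x + (r + s)) = \<phi> x" if "x \<in> D" for x
    proof -
      have "x + r \<in> D'" using that \<open>r \<in> ?X\<close> unfolding D'_def by blast
      then have "\<phi> (x + r + s) = \<phi> (x + r)" using s by blast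
      then show ?thesis using \<open>r \<in> ?X\<close> that by (simp add: add.assoc)
    qed
    then show ?thesis by blast
  qed
  have mult: "int j * s \<in> ?X" for j
  proof (induction j)
    case 0
    show ?case by simp
  next
    case (Suc j)
    have "int j * s + s \<in> ?X" using closed[OF Suc] .
    then show ?case by (simp only: of_nat_Suc distrib_right mult_1 add.commute)
  qed
  have "inj (\<lambda>j. int j * s)" using s(1) by (auto intro: injI)
  then have "infinite (range (\<lambda>j. int j * s))" by (simp add: finite_image_iff)
  moreover have "range (\<lambda>j. int j * s) \<subseteq> ?X" using mult by blast
  ultimately show False using fin finite_subset by blast
qed

text \<open>Only finitely many translates of \<open>D\<close> meet the finite set where \<theta> and
  \<phi> differ; \<open>?B\<close> collects their shifts. Every other shift that repeats the pattern
  in \<phi> also finds it in \<theta>.\<close>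

lemma infinite_asymptotic_recurrence_shifts:
  assumes "recurrent \<phi>" and "asymptotic \<theta> \<phi>" and "finite D" and "D \<noteq> {}"
  shows "infinite {r. \<forall>x\<in>D. \<theta> (x + r) = \<phi> x}"
proof -
  let ?X = "{r. \<forall>x\<in>D. \<phi> (x + r) = \<phi> x}"
  let ?B = "(\<lambda>(y, x). y - x) ` ({x. \<theta> x \<noteq> \<phi> x} \<times> D)"
  have "finite ?B" using assms(2,3) unfolding asymptotic_def by blast
  then have "infinite (?X - ?B)"
    using infinite_recurrence_shifts[OF assms(1,3,4)] by simp
  moreover have "?X - ?B \<subseteq> {r. \<forall>x\<in>D. \<theta> (x + r) = \<phi> x}"
  proof (intro subsetI CollectI ballI)
    fix r x assume r: "r \<in> ?X - ?B" and "x \<in> D"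
    have "\<theta> (x + r) = \<phi> (x + r)"
    proof (rule ccontr)
      assume "\<theta> (x + r) \<noteq> \<phi> (x + r)"
      then have "(x + r, x) \<in> {x. \<theta> x \<noteq> \<phi> x} \<times> D" using \<open>x \<in> D\<close> by simp
      then have "(\<lambda>(y, x). y - x) (x + r, x) \<in> ?B" by (rule imageI)
      then show False using r by simp
    qed
    then show "\<theta> (x + r) = \<phi> x" using r \<open>x \<in> D\<close> by simp
  qed
  ultimately show ?thesis using finite_subset by blast
qed

text \<open>A greedy choice works: the points already chosen exclude only finitely many
  integers.\<close>

lemma infinite_separated_subset:
  fixes X :: "int set"
  assumes "infinite X"
  shows "\<exists>T\<subseteq>X. finite T \<and> card T = n \<and> (\<forall>r\<in>T. \<forall>s\<in>T. r \<noteq> s \<longrightarrow> d < \<bar>r - s\<bar>)"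
proof (induction n)
  case 0
  show ?case by (rule exI[of _ "{}"]) simp
next
  case (Suc n)
  then obtain T where T: "T \<subseteq> X" "finite T" "card T = n"
    and sep: "\<forall>r\<in>T. \<forall>s\<in>T. r \<noteq> s \<longrightarrow> d < \<bar>r - s\<bar>" by blast
  have "infinite (X - (T \<union> (\<Union>r\<in>T. {r - d..r + d})))"
    using assms T(2) by simp
  then obtain s where s: "s \<in> X" "s \<notin> T" "\<And>r. r \<in> T \<Longrightarrow> s \<notin> {r - d..r + d}"
    using infinite_imp_nonempty by blast
  have "d < \<bar>s - r\<bar>" "d < \<bar>r - s\<bar>" if "r \<in> T" for r
    using s(3)[OF that] by auto
  then show ?case using T s sep by (intro exI[of _ "insert s T"]) auto
qed

section \<open>Compactness\<close>

lemma configurations_iff: "c \<in> configurations S \<longleftrightarrow> (\<forall>x. c x \<in> S)"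
  by (auto simp: configurations_def)

text \<open>Sequential compactness of the product of copies of the finite discrete space
  \<open>S\<close>. The pigeonhole principle makes one coordinate constant along a subsequence, and
  diagonalisation over an enumeration of the integers treats all coordinates. Convergence in a
  discrete space is eventual equality.\<close>

lemma configurations_seq_compact:
  fixes f :: "nat \<Rightarrow> int \<Rightarrow> 'b"
  assumes "finite S" and "\<And>i. f i \<in> configurations S"
  obtains c s where "c \<in> configurations S" "strict_mono (s :: nat \<Rightarrow> nat)"
    "\<And>x. eventually (\<lambda>i. f (s i) x = c x) sequentially"
proof -
  define P where "P n s = (\<exists>a\<in>S. \<forall>i. f (s i) (int_decode n) = a)" for n :: nat and s :: "nat \<Rightarrow> nat"
  interpret subseqs P
  proof
    fix n and s :: "nat \<Rightarrow> nat"
    let ?g = "\<lambda>i. f (s i) (int_decode n)"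
    have inS: "?g i \<in> S" for i using assms(2) by (simp add: configurations_iff)
    then have "finite (range ?g)" using assms(1) by (meson finite_subset image_subsetI)
    then obtain j where "infinite {i. ?g i = ?g j}"
      using pigeonhole_infinite[of UNIV ?g] by auto
    from infinite_enumerate[OF this]
    obtain r :: "nat \<Rightarrow> nat" where r: "strict_mono r" "\<forall>i. r i \<in> {i. ?g i = ?g j}"
      by blast
    have "P n (s \<circ> r)"
      unfolding P_def using inS[of j] r(2) by (intro bexI[of _ "?g j"]) simp_all
    then show "\<exists>r. strict_mono r \<and> P n (s \<circ> r)" using r(1) by blast
  qed
  \<comment> \<open>The diagonal sequence from index \<open>Suc n\<close> on is a subsequence of the
    one extracted for coordinate \<open>int_decode n\<close>, and \<open>P n\<close> passes to
    subsequences.\<close>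
  have "P n (diagseq \<circ> (+) (Suc n))" for n
    by (rule diagseq_holds) (auto simp: P_def)
  then have "\<forall>n. \<exists>a. a \<in> S \<and> (\<forall>i. f (diagseq (Suc n + i)) (int_decode n) = a)"
    unfolding P_def comp_def by blast
  then obtain a where a: "\<And>n. a n \<in> S" "\<And>n i. f (diagseq (Suc n + i)) (int_decode n) = a n"
    by (auto dest!: choice)
  show ?thesis
  proof
    show "(\<lambda>x. a (int_encode x)) \<in> configurations S" using a(1) by (simp add: configurations_iff)
    show "strict_mono diagseq" by (rule subseq_diagseq)
    fix x
    have "f (diagseq i) x = a (int_encode x)" if "i \<ge> Suc (int_encode x)" for i
      using a(2)[of "int_encode x" "i - Suc (int_encode x)"] that by simp
    then show "eventually (\<lambda>i. f (diagseq i) x = a (int_encode x)) sequentially"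
      by (auto simp: eventually_sequentially)
  qed
qed

text \<open>Two distributions and two positions are allowed so that the same fact serves for
  changing the configuration, for moving a pattern to another place, and for replacing \<theta> by
  \<phi>.\<close>

lemma global_update_cong:
  assumes "\<theta> x = \<phi> y" and "\<And>n. n \<in> set N \<Longrightarrow> c (x + n) = e (y + n)"
  shows "global_update N \<theta> c x = global_update N \<phi> e y"
  unfolding global_update_def using assms by (auto intro!: arg_cong[of _ _ "\<phi> y"])

lemma global_update_mem:
  assumes "\<theta> x \<in> local_rules S N" and "\<And>n. n \<in> set N \<Longrightarrow> c (x + n) \<in> S"
  shows "global_update N \<theta> c x \<in> S"
proof -
  have "map (\<lambda>n. c (x + n)) N \<in> {xs. set xs \<subseteq> S \<and> length xs = length N}"
    using assms(2) by auto
  then show ?thesis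
    using assms(1) unfolding global_update_def local_rules_def by (rule PiE_mem[rotated])
qed

text \<open>Continuity of the update rule: each value depends on finitely many cells, which
  stabilise simultaneously.\<close>

lemma global_update_eventually:
  assumes "\<And>x. eventually (\<lambda>i. f i x = c x) F"
  shows "eventually (\<lambda>i. global_update N \<theta> (f i) x = global_update N \<theta> c x) F"
proof -
  have "eventually (\<lambda>i. \<forall>n\<in>set N. f i (x + n) = c (x + n)) F"
    using assms by (intro eventually_ball_finite) auto
  then show ?thesis by eventually_elim (auto intro: global_update_cong)
qed

lemma eventually_mem_window:
  assumes "strict_mono (s :: nat \<Rightarrow> nat)"
  shows "eventually (\<lambda>i. x \<in> {- int (s i)..int (s i)}) sequentially"
proof -
  have "x \<in> {- int (s i)..int (s i)}" if "nat \<bar>x\<bar> \<le> i" for i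
    using that seq_suble[OF assms, of i] by auto
  then show ?thesis by (auto simp: eventually_sequentially)
qed

text \<open>If \<open>d\<close> could be matched on every window, a limit of the matching
  configurations would be a preimage of \<open>d\<close>.\<close>

lemma ex_orphan_window:
  assumes "finite S" and "d \<notin> global_update N \<theta> ` configurations S"
  obtains m :: nat where
    "\<And>c. c \<in> configurations S \<Longrightarrow> \<exists>x\<in>{- int m..int m}. global_update N \<theta> c x \<noteq> d x"
proof (rule ccontr)
  assume "\<not> thesis"
  then have "\<forall>m. \<exists>c. c \<in> configurations S \<and>
      (\<forall>x\<in>{- int m..int m}. global_update N \<theta> c x = d x)"
    using that by blast
  then obtain f where f: "\<And>m. f m \<in> configurations S"
    "\<And>m x. x \<in> {- int m..int m} \<Longrightarrow> global_update N \<theta> (f m) x = d x"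
    by metis
  obtain c s where c: "c \<in> configurations S" "strict_mono s"
    "\<And>x. eventually (\<lambda>i. f (s i) x = c x) sequentially"
    using configurations_seq_compact[of S f] assms(1) f(1) by blast
  have "global_update N \<theta> c x = d x" for x
  proof -
    have "eventually (\<lambda>i. global_update N \<theta> c x = d x) sequentially"
      using global_update_eventually[of "\<lambda>i. f (s i)", OF c(3), of N \<theta> x]
        eventually_mem_window[OF c(2), of x]
      by eventually_elim (use f(2) in metis)
    then show ?thesis by simp
  qed
  then have "global_update N \<theta> c = d" by blast
  then show False using c(1) assms(2) by blast
qed

text \<open>The inverse of an injective update is uniformly continuous on the image. Otherwise there
  are pairs that differ on \<open>D\<close> while their images agree on ever larger windows. In the
  limit the images are equal, so the two limits coincide by injectivity, and the pairs eventually
  agree on the finite set \<open>D\<close>.\<close>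

lemma ex_determining_window:
  assumes "finite S" and "inj_on (global_update N \<theta>) (configurations S)" and "finite D"
  obtains m :: nat where
    "\<And>c e x. \<lbrakk>c \<in> configurations S; e \<in> configurations S; x \<in> D;
       \<And>y. y \<in> {- int m..int m} \<Longrightarrow> global_update N \<theta> c y = global_update N \<theta> e y\<rbrakk> \<Longrightarrow> c x = e x"
proof (rule ccontr)
  assume "\<not> thesis"
  then have "\<forall>m. \<exists>c e. c \<in> configurations S \<and> e \<in> configurations S \<and> (\<exists>x\<in>D. c x \<noteq> e x) \<and>
      (\<forall>y\<in>{- int m..int m}. global_update N \<theta> c y = global_update N \<theta> e y)"
    using that by meson
  then obtain f g where fg: "\<And>m. f m \<in> configurations S" "\<And>m. g m \<in> configurations S"
      "\<And>m. \<exists>x\<in>D. f m x \<noteq> g m x"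
      "\<And>m y. y \<in> {- int m..int m} \<Longrightarrow> global_update N \<theta> (f m) y = global_update N \<theta> (g m) y"
    by metis
  \<comment> \<open>Pairing the two sequences yields one subsequence along which both
    converge.\<close>
  have "(\<lambda>x. (f i x, g i x)) \<in> configurations (S \<times> S)" for i
    using fg(1,2) by (simp add: configurations_iff)
  then obtain h s where h: "h \<in> configurations (S \<times> S)" "strict_mono s"
    "\<And>x. eventually (\<lambda>i. (f (s i) x, g (s i) x) = h x) sequentially"
    using configurations_seq_compact[of "S \<times> S" "\<lambda>i x. (f i x, g i x)"] assms(1) by auto
  define c e where "c = fst \<circ> h" and "e = snd \<circ> h"
  have ce: "c \<in> configurations S" "e \<in> configurations S"
    using h(1) by (auto simp: configurations_iff c_def e_def mem_Times_iff)
  have fc: "eventually (\<lambda>i. f (s i) x = c x) sequentially"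
    and ge: "eventually (\<lambda>i. g (s i) x = e x) sequentially" for x
    using h(3)[of x] by (auto simp: c_def e_def elim!: eventually_mono dest: sym)
  have "global_update N \<theta> c x = global_update N \<theta> e x" for x
  proof -
    have "eventually (\<lambda>i. global_update N \<theta> c x = global_update N \<theta> e x) sequentially"
      using global_update_eventually[of "\<lambda>i. f (s i)", OF fc, of N \<theta> x]
        global_update_eventually[of "\<lambda>i. g (s i)", OF ge, of N \<theta> x]
        eventually_mem_window[OF h(2), of x]
      by eventually_elim (use fg(4) in metis)
    then show ?thesis by simp
  qed
  then have "c = e" using assms(2) ce by (auto dest: inj_onD)
  have "eventually (\<lambda>i. \<forall>x\<in>D. f (s i) x = g (s i) x) sequentially"
  proof (rule eventually_ball_finite[OF assms(3)], rule ballI)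
    fix x show "eventually (\<lambda>i. f (s i) x = g (s i) x) sequentially"
      using fc[of x] ge[of x] by eventually_elim (simp add: \<open>c = e\<close>)
  qed
  then have "eventually (\<lambda>i::nat. False) sequentially"
    by eventually_elim (use fg(3) in blast)
  then show False by simp
qed

section \<open>Counting preimages\<close>

text \<open>Bernoulli's inequality gives (1 + 1/t)^n >= 1 + n/t, which for n = t^2 is 1 + t > t. The
  extra factors \<open>t\<close> below clear denominators. This fixes how many occurrences the
  counting argument uses.\<close>

lemma power_Suc_less_Suc_power:
  fixes t :: nat
  assumes "t > 0"
  shows "t ^ Suc (t\<^sup>2) < (t + 1) ^ (t\<^sup>2)"
proof -
  have bernoulli: "t ^ n * (t + n) \<le> (t + 1) ^ n * t" for n
  proof (induction n)
    case (Suc n)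
    have "t ^ Suc n * (t + Suc n) \<le> (t + 1) * (t ^ n * (t + n))"
      by (simp add: algebra_simps)
    also have "\<dots> \<le> (t + 1) * ((t + 1) ^ n * t)" using Suc by (rule mult_left_mono) simp
    finally show ?case by (simp only: power_Suc mult.assoc)
  qed simp
  have "t ^ Suc (t\<^sup>2) * t = t ^ t\<^sup>2 * t\<^sup>2"
    by (simp only: power_Suc power2_eq_square mult_ac)
  also have "\<dots> < t ^ t\<^sup>2 * (t + t\<^sup>2)"
    using assms by (intro mult_strict_left_mono) simp_all
  also have "\<dots> \<le> (t + 1) ^ t\<^sup>2 * t" by (rule bernoulli)
  finally show ?thesis by (simp only: mult_less_cancel2)
qed

text \<open>Suppose \<open>p\<close> had more than t = |S|^(2k) preimages. Filling n separated
  occurrences of the window in \<theta> with arbitrary preimages, and the rest of \<open>U\<close>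
  with arbitrary states, gives at least (t+1)^n |S|^|U-A| configurations. Their images can differ
  only on \<open>V - B\<close>, which leaves at most t^(n+1) |S|^|U-A| images. For n = t^2 this
  contradicts injectivity.\<close>

lemma card_preimages_le:
  fixes k :: nat
  assumes "finite S" and "\<theta> \<in> configurations (local_rules S N)"
    and inj: "inj_on (global_update N \<theta>) (configurations S)"
    and N: "\<And>n. n \<in> set N \<Longrightarrow> \<bar>n\<bar> \<le> int k" and "a \<le> b"
    and inf: "infinite {r. \<forall>x\<in>{a..b}. \<theta> (x + r) = \<phi> x}"
  shows "card {c \<in> {a - int k..b + int k} \<rightarrow>\<^sub>E S. \<forall>x\<in>{a..b}. global_update N \<phi> c x = p x}
    \<le> card S ^ (2 * k)" (is "card ?Q \<le> ?t")
proof (rule ccontr)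
  assume "\<not> card ?Q \<le> ?t"
  then have q: "?t + 1 \<le> card ?Q" by linarith
  then have "card ?Q \<noteq> 0" by linarith
  then have "?Q \<noteq> {}" by (rule contrapos_nn) (simp only: card.empty)
  then obtain c0 where "c0 \<in> {a - int k..b + int k} \<rightarrow>\<^sub>E S" by blast
  then have "c0 a \<in> S" by (rule PiE_mem) (use \<open>a \<le> b\<close> in simp)
  then obtain s0 where s0: "s0 \<in> S" by blast
  then have cS: "card S > 0" using \<open>finite S\<close> by (auto simp: card_gt_0_iff)
  define n where "n = ?t\<^sup>2"
  \<comment> \<open>The separation makes the neighbourhoods \<open>J r\<close>, of
    \<open>b - a + 1 + 2 * k\<close> cells each, pairwise disjoint.\<close>
  obtain T where T: "T \<subseteq> {r. \<forall>x\<in>{a..b}. \<theta> (x + r) = \<phi> x}" "finite T" "card T = n"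
    "\<forall>r\<in>T. \<forall>s\<in>T. r \<noteq> s \<longrightarrow> b - a + 2 * int k < \<bar>r - s\<bar>"
    using infinite_separated_subset[OF inf, of n "b - a + 2 * int k"] by (elim exE conjE)
  define I J where "I r = {a + r..b + r}" and "J r = {a + r - int k..b + r + int k}" for r
  define A B where "A = (\<Union>r\<in>T. J r)" and "B = (\<Union>r\<in>T. I r)"
  define w where "w = nat (b - a + 1)"
  have IJ: "I r \<subseteq> J r" for r by (auto simp: I_def J_def)
  have J_unique: "r = s" if "r \<in> T" "s \<in> T" "x \<in> J r" "x \<in> J s" for r s x
    using T(4) that by (force simp: J_def)
  have finAB: "finite A" "finite B" unfolding A_def B_def I_def J_def using T(2) by auto
  have "card A = (\<Sum>r\<in>T. card (J r))" unfolding A_def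
  proof (rule card_UN_disjoint)
    show "\<forall>r\<in>T. \<forall>s\<in>T. r \<noteq> s \<longrightarrow> J r \<inter> J s = {}" using J_unique by blast
  qed (use T(2) in \<open>auto simp: J_def\<close>)
  moreover have "card (J r) = w + 2 * k" for r
    using \<open>a \<le> b\<close> unfolding J_def w_def by simp
  ultimately have cA: "card A = n * (w + 2 * k)" using T(3) by simp
  have "card B = (\<Sum>r\<in>T. card (I r))" unfolding B_def
  proof (rule card_UN_disjoint)
    show "\<forall>r\<in>T. \<forall>s\<in>T. r \<noteq> s \<longrightarrow> I r \<inter> I s = {}" using J_unique IJ by blast
  qed (use T(2) in \<open>auto simp: I_def\<close>)
  moreover have "card (I r) = w" for r
    using \<open>a \<le> b\<close> unfolding I_def w_def by simp
  ultimately have cB: "card B = n * w" using T(3) by simp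
  have "bdd_above (abs ` A)" using finAB(1) by simp
  then obtain l0 where l0: "\<And>x. x \<in> A \<Longrightarrow> \<bar>x\<bar> \<le> l0" by (auto simp: bdd_above_def)
  define l where "l = nat l0"
  \<comment> \<open>\<open>U\<close> holds everything that varies; its
    \<open>k\<close>-neighbourhood \<open>V\<close> holds every cell whose new value can see a cell
    of \<open>U\<close>.\<close>
  define U V where "U = {- int l..int l}" and "V = {- int l - int k..int l + int k}"
  have AU: "A \<subseteq> U" using l0 by (force simp: U_def l_def)
  have "B \<subseteq> A" unfolding A_def B_def using IJ by blast
  have BV: "B \<subseteq> V" using \<open>B \<subseteq> A\<close> AU by (force simp: U_def V_def)
  have cUV: "card V = card U + 2 * k" unfolding U_def V_def by simp
  have cAB: "card A = card B + 2 * k * n" using cA cB by (simp add: algebra_simps)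
  have cardUA: "card (U - A) + card A = card U"
    using AU finAB(1) by (metis U_def card_Diff_subset card_mono finite_atLeastAtMost_int le_add_diff_inverse2)
  have cardVB: "card (V - B) + card B = card V"
    using BV finAB(2) by (metis V_def card_Diff_subset card_mono finite_atLeastAtMost_int le_add_diff_inverse2)

  define \<rho> where "\<rho> x = (THE r. r \<in> T \<and> x \<in> J r)" for x
  have \<rho>: "\<rho> x = r" if "r \<in> T" "x \<in> J r" for x r
    unfolding \<rho>_def using that J_unique by blast
  \<comment> \<open>On each \<open>J r\<close> a translated preimage \<open>u r\<close> is copied;
    \<open>v\<close> fills the remainder of \<open>U\<close>, and the fixed state \<open>s0\<close>
    lies outside.\<close>
  define g where "g = (\<lambda>(u, v) x. if x \<in> A then u (\<rho> x) (x - \<rho> x) else if x \<in> U then v x else s0)"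
  define Z where "Z = (T \<rightarrow>\<^sub>E ?Q) \<times> (U - A \<rightarrow>\<^sub>E S)"
  have gJ: "g (u, v) x = u r (x - r)" if "r \<in> T" "x \<in> J r" for u v x r
    using that \<rho>[OF that] by (auto simp: g_def A_def)
  have gU: "g (u, v) x = v x" if "x \<in> U - A" for u v x
    using that by (simp add: g_def)
  have g0: "g (u, v) x = s0" if "x \<notin> U" for u v x
    using that AU by (auto simp: g_def)
  have shift: "x - r \<in> {a - int k..b + int k} \<longleftrightarrow> x \<in> J r" for x r
    by (auto simp: J_def)
  have g_conf: "g z \<in> configurations S" if "z \<in> Z" for z
  proof -
    obtain u v where z: "z = (u, v)" by (cases z)
    have u: "u \<in> T \<rightarrow>\<^sub>E ?Q" and v: "v \<in> U - A \<rightarrow>\<^sub>E S" using that z by (auto simp: Z_def)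
    have "g z x \<in> S" for x
    proof -
      consider r where "r \<in> T" "x \<in> J r" | "x \<in> U - A" | "x \<notin> U" by (auto simp: A_def)
      then show ?thesis
      proof cases
        case 1
        have "u r \<in> {a - int k..b + int k} \<rightarrow>\<^sub>E S" using PiE_mem[OF u 1(1)] by simp
        then have "u r (x - r) \<in> S" using shift 1(2) by (metis PiE_mem)
        then show ?thesis using gJ[OF 1] z by simp
      next
        case 2
        then show ?thesis using gU[OF 2] z PiE_mem[OF v 2] by simp
      next
        case 3
        then show ?thesis using g0[OF 3] z s0 by simp
      qed
    qed
    then show ?thesis by (simp add: configurations_iff)
  qed
  have g_inj: "inj_on g Z"
  proof (rule inj_onI)
    fix z z' assume z: "z \<in> Z" "z' \<in> Z" and eq: "g z = g z'"
    obtain u v u' v' where uv: "z = (u, v)" "z' = (u', v')" by (cases z, cases z')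
    have "u r y = u' r y" if "r \<in> T" for r y
    proof (cases "y \<in> {a - int k..b + int k}")
      case True
      then have "y + r \<in> J r" by (auto simp: J_def)
      then show ?thesis
        using gJ[OF that, of "y + r" u v] gJ[OF that, of "y + r" u' v'] eq uv by simp
    next
      case False
      \<comment> \<open>Values of \<open>u r\<close> off the window leave no trace in
        \<open>g\<close>; extensionality determines them.\<close>
      have "u r \<in> ?Q" "u' r \<in> ?Q" using z uv that by (auto simp: Z_def dest: PiE_mem)
      then have "u r \<in> extensional {a - int k..b + int k}" "u' r \<in> extensional {a - int k..b + int k}"
        by (auto simp: PiE_def)
      then show ?thesis using False by (metis extensional_arb)
    qed
    moreover have "u \<in> extensional T" "u' \<in> extensional T" using z uv by (auto simp: Z_def PiE_def)
    ultimately have "u = u'" by (metis extensionalityI ext)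
    moreover have "v x = v' x" if "x \<in> U - A" for x
      using gU[OF that] eq uv by metis
    moreover have "v \<in> extensional (U - A)" "v' \<in> extensional (U - A)"
      using z uv by (auto simp: Z_def PiE_def)
    ultimately show "z = z'" using uv extensionalityI by metis
  qed
  \<comment> \<open>The image on \<open>B\<close> is prescribed by \<open>p\<close>, and outside
    \<open>V\<close> it is that of the constant configuration, so \<open>V - B\<close> carries all
    the information.\<close>
  define h where "h z = restrict (global_update N \<theta> (g z)) (V - B)" for z
  have H_S: "global_update N \<theta> (g z) x \<in> S" if "z \<in> Z" for z x
    using assms(2) g_conf[OF that] by (intro global_update_mem) (auto simp: configurations_iff)
  have H_B: "global_update N \<theta> (g z) x = p (x - \<rho> x)" if zZ: "z \<in> Z" and xB: "x \<in> B" for z x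
  proof -
    obtain u v where z: "z = (u, v)" by (cases z)
    obtain r where r: "r \<in> T" "x \<in> I r" using xB by (auto simp: B_def)
    have "u \<in> T \<rightarrow>\<^sub>E ?Q" using zZ z by (auto simp: Z_def)
    then have ur: "u r \<in> ?Q" using r(1) by (rule PiE_mem)
    have xr: "x - r \<in> {a..b}" using r(2) by (auto simp: I_def)
    have "\<theta> (x - r + r) = \<phi> (x - r)" using T(1) r(1) xr by blast
    then have "global_update N \<theta> (g z) x = global_update N \<phi> (u r) (x - r)"
    proof (intro global_update_cong)
      fix m assume "m \<in> set N"
      then have "x + m \<in> J r" using N[of m] r(2) by (auto simp: I_def J_def)
      from gJ[OF r(1) this, of u v] show "g z (x + m) = u r (x - r + m)"
        by (simp add: z algebra_simps)
    qed simp
    also have "\<dots> = p (x - r)" using ur xr by blast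
    also have "r = \<rho> x" using r IJ \<rho> by blast
    finally show ?thesis .
  qed
  have H_V: "global_update N \<theta> (g z) x = global_update N \<theta> (\<lambda>_. s0) x" if "x \<notin> V" for z x
  proof (rule global_update_cong)
    fix m assume "m \<in> set N"
    then have "x + m \<notin> U" using N[of m] that by (auto simp: U_def V_def)
    then show "g z (x + m) = s0" using g0 by (cases z) simp
  qed simp
  have "inj_on h Z"
  proof (rule inj_onI)
    fix z z' assume z: "z \<in> Z" "z' \<in> Z" and eq: "h z = h z'"
    have "global_update N \<theta> (g z) x = global_update N \<theta> (g z') x" for x
    proof -
      consider "x \<in> B" | "x \<in> V - B" | "x \<notin> V" by blast
      then show ?thesis
      proof cases
        case 1
        then show ?thesis using H_B z by metis
      next
        case 2
        then show ?thesis using fun_cong[OF eq, of x] by (simp add: h_def)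
      next
        case 3
        then show ?thesis using H_V by metis
      qed
    qed
    then have "g z = g z'" using inj g_conf z by (blast dest: inj_onD)
    then show "z = z'" using g_inj z by (blast dest: inj_onD)
  qed
  moreover have "h ` Z \<subseteq> V - B \<rightarrow>\<^sub>E S"
    unfolding h_def using H_S by (intro image_subsetI) (simp add: restrict_PiE_iff)
  moreover have "finite (V - B \<rightarrow>\<^sub>E S)" using \<open>finite S\<close> by (intro finite_PiE) (auto simp: V_def)
  ultimately have "card Z \<le> card (V - B \<rightarrow>\<^sub>E S)" by (rule card_inj_on_le)
  moreover have "card Z = card ?Q ^ n * card S ^ card (U - A)"
    unfolding Z_def using T(2,3) by (simp add: card_cartesian_product card_funcsetE U_def)
  moreover have "card (V - B \<rightarrow>\<^sub>E S) = card S ^ card (V - B)"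
    by (rule card_funcsetE) (simp add: V_def)
  \<comment> \<open>Passing from \<open>U\<close> to \<open>V\<close> adds \<open>2 * k\<close>
    cells, and each of the \<open>n\<close> occurrences adds \<open>2 * k\<close> more, since
    \<open>I r\<close> is smaller than \<open>J r\<close> by that amount.\<close>
  moreover have "card (V - B) = card (U - A) + 2 * k * Suc n"
    using cardUA cardVB cUV cAB by simp
  ultimately have "card ?Q ^ n * card S ^ card (U - A) \<le> ?t ^ Suc n * card S ^ card (U - A)"
    by (simp only: power_add power_mult mult.commute[of _ "card S ^ card (U - A)"])
  then have "card ?Q ^ n \<le> ?t ^ Suc n" using cS by simp
  moreover have "(?t + 1) ^ n \<le> card ?Q ^ n" using q by (rule power_mono) simp
  moreover have "?t ^ Suc n < (?t + 1) ^ n"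
    unfolding n_def using cS by (intro power_Suc_less_Suc_power) simp
  ultimately show False by linarith
qed

text \<open>Averaging: at least \<open>t * card Y\<close> points share fewer than
  \<open>card Y\<close> values.\<close>

lemma ex_card_fibre_gt:
  assumes "finite X" and "finite Y" and "f ` X \<subset> Y" and "t * card Y \<le> card X" and "t > 0"
  shows "\<exists>y. t < card {x \<in> X. f x = y}"
proof (rule ccontr)
  assume "\<nexists>y. t < card {x \<in> X. f x = y}"
  then have le: "card {x \<in> X. f x = y} \<le> t" for y by (meson not_less)
  have "X = (\<Union>y\<in>f ` X. {x \<in> X. f x = y})" by blast
  then have "card X \<le> (\<Sum>y\<in>f ` X. card {x \<in> X. f x = y})"
    using card_UN_le[of "f ` X" "\<lambda>y. {x \<in> X. f x = y}"] assms(1) by simp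
  also have "\<dots> \<le> card (f ` X) * t" using sum_bounded_above[of "f ` X", OF le] by simp
  also have "\<dots> < card Y * t" using psubset_card_mono[OF assms(2,3)] assms(5) by simp
  finally show False using assms(4) by (simp add: mult.commute)
qed

section \<open>From an orphan of \<theta> to a pattern on a window of \<phi> with too many
  preimages\<close>

theorem theorem5:
  fixes S :: "'a set" and N :: "int list"
    and R :: "('a list \<Rightarrow> 'a) set"
    and \<theta> \<phi> :: "int \<Rightarrow> 'a list \<Rightarrow> 'a"
  assumes "finite S"
    and "finite R"
    and "R \<subseteq> local_rules S N"
    and "\<theta> \<in> configurations R"
    and "\<phi> \<in> configurations R"
    and "recurrent \<phi>"
    and "asymptotic \<theta> \<phi>"
    and "inj_on (global_update N \<theta>) (configurations S)"
  shows "global_update N \<theta> ` configurations S = configurations S"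
proof (rule ccontr)
  let ?H = "global_update N \<theta>"
  assume neq: "?H ` configurations S \<noteq> configurations S"
  have rules: "\<theta> x \<in> local_rules S N" for x
    using assms(3,4) by (auto simp: configurations_iff)
  have H_S: "?H c x \<in> S" if "c \<in> configurations S" for c x
    using that by (intro global_update_mem rules) (simp add: configurations_iff)
  then have "?H ` configurations S \<subseteq> configurations S"
    by (auto simp: configurations_iff)
  with neq obtain d where d: "d \<in> configurations S" "d \<notin> ?H ` configurations S" by blast
  define s0 where "s0 = d 0"
  have s0: "s0 \<in> S" using d(1) by (simp add: configurations_iff s0_def)
  have cS: "card S > 0" using s0 \<open>finite S\<close> by (auto simp: card_gt_0_iff)
  \<comment> \<open>The sum of the moduli bounds each of them, and also makes sense for an empty
    neighbourhood.\<close>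
  define k where "k = (\<Sum>n\<leftarrow>N. nat \<bar>n\<bar>)"
  have N: "\<bar>n\<bar> \<le> int k" if "n \<in> set N" for n
    using member_le_sum_list[of "nat \<bar>n\<bar>" "map (\<lambda>n. nat \<bar>n\<bar>) N"] that by (simp add: k_def)
  define D where "D = {x. \<theta> x \<noteq> \<phi> x}"
  have finD: "finite D" using assms(7) by (simp add: asymptotic_def D_def)
  \<comment> \<open>The cells read by the rules at positions in \<open>D\<close>.\<close>
  define D' where "D' = (\<Union>n\<in>set N. (\<lambda>x. x + n) ` D)"
  have "finite D'" using finD by (simp add: D'_def)
  obtain m1 where m1:
    "\<And>c. c \<in> configurations S \<Longrightarrow> \<exists>x\<in>{- int m1..int m1}. ?H c x \<noteq> d x"
    using ex_orphan_window[OF \<open>finite S\<close> d(2)] by blast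
  obtain m2 where m2:
    "\<And>c e x. \<lbrakk>c \<in> configurations S; e \<in> configurations S; x \<in> D';
       \<And>y. y \<in> {- int m2..int m2} \<Longrightarrow> ?H c y = ?H e y\<rbrakk> \<Longrightarrow> c x = e x"
    using ex_determining_window[OF \<open>finite S\<close> assms(8) \<open>finite D'\<close>] by blast
  \<comment> \<open>Both window properties persist on larger windows, so one \<open>m\<close> serves
    for the orphan and for the determination of \<open>D'\<close>; the sum makes the window contain
    \<open>D\<close>.\<close>
  define m where "m = max (max m1 m2) (\<Sum>x\<in>D. nat \<bar>x\<bar>)"
  have Dm: "D \<subseteq> {- int m..int m}"
  proof
    fix x assume "x \<in> D"
    then have "nat \<bar>x\<bar> \<le> m"
      using member_le_sum[of x D "\<lambda>x. nat \<bar>x\<bar>"] finD by (simp add: m_def)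
    then show "x \<in> {- int m..int m}" by auto
  qed
  let ?W = "{- int m..int m}" and ?W' = "{- int m - int k..int m + int k}"
  \<comment> \<open>Patterns are extensional, hence undefined off \<open>?W'\<close>. Filling with
    \<open>s0\<close> gives genuine configurations, with the same image on
    \<open>?W\<close>.\<close>
  define ext where "ext c x = (if x \<in> ?W' then c x else s0)" for c :: "int \<Rightarrow> 'a" and x
  have ext_conf: "ext c \<in> configurations S" if "c \<in> ?W' \<rightarrow>\<^sub>E S" for c
    using that s0 by (auto simp: ext_def configurations_iff dest: PiE_mem)
  have H_ext: "?H (ext c) x = ?H c x" if "x \<in> ?W" for c x
    using that N by (intro global_update_cong) (force simp: ext_def)+
  define F where "F c = restrict (?H c) ?W" for c
  have "F ` (?W' \<rightarrow>\<^sub>E S) \<subseteq> ?W \<rightarrow>\<^sub>E S"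
  proof (intro image_subsetI)
    fix c assume c: "c \<in> ?W' \<rightarrow>\<^sub>E S"
    have "?H (ext c) x \<in> S" for x
      using H_S ext_conf[OF c] by blast
    then show "F c \<in> ?W \<rightarrow>\<^sub>E S" unfolding F_def restrict_PiE_iff using H_ext by metis
  qed
  moreover have "restrict d ?W \<in> ?W \<rightarrow>\<^sub>E S" using d(1) by (simp add: configurations_iff)
  moreover have "restrict d ?W \<notin> F ` (?W' \<rightarrow>\<^sub>E S)"
  proof
    assume "restrict d ?W \<in> F ` (?W' \<rightarrow>\<^sub>E S)"
    then obtain c where c: "c \<in> ?W' \<rightarrow>\<^sub>E S" and eq: "restrict d ?W = F c" by blast
    obtain x where x: "x \<in> {- int m1..int m1}" "?H (ext c) x \<noteq> d x"
      using m1[OF ext_conf[OF c]] by blast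
    have "x \<in> ?W" using x(1) by (auto simp: m_def)
    then show False using x(2) H_ext fun_cong[OF eq, of x] by (simp add: F_def)
  qed
  ultimately have "F ` (?W' \<rightarrow>\<^sub>E S) \<subset> ?W \<rightarrow>\<^sub>E S" by blast
  moreover have "finite (?W' \<rightarrow>\<^sub>E S)" "finite (?W \<rightarrow>\<^sub>E S)"
    using \<open>finite S\<close> by (auto intro: finite_PiE)
  \<comment> \<open>Hence there are at least |S|^(2k) patterns on \<open>?W'\<close> for each
    pattern on \<open>?W\<close>; as the orphan is missed, some fibre is larger.\<close>
  moreover have "card ?W' = 2 * k + card ?W" by simp
  then have "card S ^ (2 * k) * card (?W \<rightarrow>\<^sub>E S) \<le> card (?W' \<rightarrow>\<^sub>E S)"
    by (simp only: card_funcsetE finite_atLeastAtMost_int power_add)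
  ultimately obtain p where p: "card S ^ (2 * k) < card {c \<in> ?W' \<rightarrow>\<^sub>E S. F c = p}" (is "_ < card ?P")
    using ex_card_fibre_gt[of "?W' \<rightarrow>\<^sub>E S" "?W \<rightarrow>\<^sub>E S" F "card S ^ (2 * k)"] cS by auto
  then have "card ?P \<noteq> 0" by linarith
  then have "?P \<noteq> {}" by (rule contrapos_nn) (simp only: card.empty)
  then obtain q where q: "q \<in> ?P" by blast
  have agree: "c x = q x" if c: "c \<in> ?P" and x: "x \<in> D'" for c x
  proof -
    have "ext c x = ext q x"
    proof (rule m2[OF _ _ x])
      show "ext c \<in> configurations S" "ext q \<in> configurations S" using c q ext_conf by auto
      fix y assume "y \<in> {- int m2..int m2}"
      then have y: "y \<in> ?W" by (auto simp: m_def)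
      have "F c y = F q y" using c q by simp
      then show "?H (ext c) y = ?H (ext q) y"
        using H_ext[OF y] y by (simp add: F_def)
    qed
    moreover have "x \<in> ?W'" using x Dm N by (force simp: D'_def)
    ultimately show ?thesis by (simp add: ext_def)
  qed
  \<comment> \<open>All preimages of \<open>p\<close> coincide around \<open>D\<close>, so replacing \<open>\<theta>\<close> by \<open>\<phi>\<close> maps them to one pattern.\<close>
  define p' where "p' x = (if x \<in> D then global_update N \<phi> q x else p x)" for x
  let ?P' = "{c \<in> ?W' \<rightarrow>\<^sub>E S. \<forall>x\<in>?W. global_update N \<phi> c x = p' x}"
  have "?P \<subseteq> ?P'"
  proof (intro subsetI CollectI conjI ballI)
    fix c x assume c: "c \<in> ?P" and x: "x \<in> ?W"
    show "global_update N \<phi> c x = p' x"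
    proof (cases "x \<in> D")
      case True
      then have "global_update N \<phi> c x = global_update N \<phi> q x"
        using agree[OF c] by (intro global_update_cong) (auto simp: D'_def)
      then show ?thesis using True by (simp add: p'_def)
    next
      case False
      then have "global_update N \<phi> c x = ?H c x" by (intro global_update_cong) (auto simp: D_def)
      also have "\<dots> = F c x" using x by (simp add: F_def)
      also have "\<dots> = p x" using c by blast
      finally show ?thesis using False by (simp add: p'_def)
    qed
  qed blast
  then have "card ?P \<le> card ?P'"
    using \<open>finite (?W' \<rightarrow>\<^sub>E S)\<close> by (intro card_mono) auto
  \<comment> \<open>The bound on preimages under \<phi> comes from injectivity of the update by
    \<theta>, in which the restriction of \<phi> to \<open>?W\<close> occurs infinitely
    often.\<close>
  also have "\<dots> \<le> card S ^ (2 * k)"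
  proof (rule card_preimages_le)
    show "\<theta> \<in> configurations (local_rules S N)" using rules by (simp add: configurations_iff)
    show "infinite {r. \<forall>x\<in>?W. \<theta> (x + r) = \<phi> x}"
      by (rule infinite_asymptotic_recurrence_shifts[OF assms(6,7)]) auto
  qed (use assms(1,8) N in auto)
  finally show False using p by simp
qed

end
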